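(* For all $X,Y\in\mathrm{evC}$, the following are equivalent: (i) $X\sim Y$; (ii) $\mathrm{NF}_{\sim}(X)=\mathrm{NF}_{\sim}(Y)$; (iii) $\mathsf{SS}(\delta X)=\mathsf{SS}(\delta Y)$.
   Context: $\mathbb{K}$ is an integral domain, $\mathbb{N}=\{1,2,\ldots\}$, $d\in\mathbb{N}$ is fixed; $\mathbb{N}^2$ carries the product order. $\mathrm{evC}$ is the $\mathbb{K}$-module of eventually constant functions $X:\mathbb{N}^2\to\mathbb{K}^d$, i.e. those for which there is $\boldsymbol{n}\in\mathbb{N}^2$ such that $X$ is constant on $\{\boldsymbol{i}\in\mathbb{N}^2\mid\boldsymbol{i}\not\leq\boldsymbol{n}\}$; the least such $\boldsymbol{n}$ is called $\mathsf{size}(X)=(\mathsf{rows}(X),\mathsf{cols}(X))$. $\mathrm{evZ}\subseteq\mathrm{evC}$ is the submodule of functions of finite support. For $(a,k)\in\{1,2\}\times\mathbb{N}$, $\mathsf{warp}_{a,k}:\mathrm{evC}\to\mathrm{evC}$ is $(\mathsf{warp}_{a,k}X)_{\boldsymbol{i}}=X_{\boldsymbol{i}}$ if $\boldsymbol{i}_a\leq k$ and $X_{\boldsymbol{i}-e_a}$ if $\boldsymbol{i}_a>k$. For each $A\in\mathrm{evC}$, the warping normal form $\mathrm{NF}_{\mathsf{warp}}(A)$ is the unique $B\in\mathrm{evC}$ such that $A$ is obtained from $B$ by applying finitely many (possibly zero) operations $\mathsf{warp}_{a,k}$ and $B$ has no repeated rows or columns before its constant part, i.e. rows $i$ and $i+1$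 of $B$ differ for all $1\leq i<\mathsf{rows}(B)$ and columns $j$ and $j+1$ of $B$ differ for all $1\leq j<\mathsf{cols}(B)$. The difference operator $\delta:\mathrm{evC}\to\mathrm{evZ}$ is $(\delta X)_{i,j}=X_{i+1,j+1}-X_{i+1,j}-X_{i,j+1}+X_{i,j}$; its kernel consists of the constant functions. The map $\varsigma:\mathrm{evZ}\to\mathrm{evC}$, $(\varsigma Z)_{i,j}=\sum_{s\geq i}\sum_{t\geq j}Z_{s,t}$, is a right inverse of $\delta$. Put $\mathrm{NF}_{\ker(\delta)}=\varsigma\circ\delta$ and $\mathrm{NF}_{\sim}=\mathrm{NF}_{\ker(\delta)}\circ\mathrm{NF}_{\mathsf{warp}}$. The relation $\sim$ (equivalence modulo constants or warping) is the transitive closure on $\mathrm{evC}$ of the union of the two equivalence relations "$X-Y\in\ker(\delta)$" and "$\mathrm{NF}_{\mathsf{warp}}(X)=\mathrm{NF}_{\mathsf{warp}}(Y)$". $(\mathfrak{M}_d,\star,\varepsilon)$ is the free commutative monoid generated by $d$ letters $\mathbf{1},\ldots,\mathbf{d}$. A non-empty matrix composition is a matrix $\mathbf{a}\in\mathfrak{M}_d^{m\times n}$ ($m,n\geq1$) such that no row and no column consists only of entries $\varepsilon$; $\mathrm{Cmp}$ is the set of all these together with the empty composition $\mathsf{e}$. For $z\in\mathbb{K}^d$, $\lambda\mapsto z^{(\lambda)}$ is the monoid homomorphism from $\mathfrak{M}_d$ to the multiplicative monoid of $\mathbb{K}$ with $z^{(\mathbf{j})}=z_j$. For $Z\in\mathrm{evZ}$,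 the two-parameter sums signature $\mathsf{SS}(Z)$ is the function $\mathrm{Cmp}\to\mathbb{K}$, $\mathbf{a}\mapsto\langle\mathsf{SS}(Z),\mathbf{a}\rangle$, with $\langle\mathsf{SS}(Z),\mathsf{e}\rangle=1$ and, for $\mathbf{a}$ of size $m\times n$, $$\langle\mathsf{SS}(Z),\mathbf{a}\rangle=\sum_{\substack{1\leq\iota_1<\cdots<\iota_m\\1\leq\kappa_1<\cdots<\kappa_n}}\ \prod_{s=1}^{m}\prod_{t=1}^{n}Z_{\iota_s,\kappa_t}^{(\mathbf{a}_{s,t})}.$$ *)

theory Defs
  imports
    "HOL-Analysis.Finite_Cartesian_Product"
    "HOL-Analysis.Abstract_Topology_2"
    "HOL-Library.Product_Order"
    "HOL-Library.Product_Plus"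
    "HOL-Library.Multiset"
    "HOL-Library.FuncSet"
    "Jordan_Normal_Form.Matrix"
begin

text \<open>
  Conventions. The positive integers 1, 2, 3, ... are represented by their predecessors, i.e. by the
  type \<^typ>\<open>nat\<close>, through the order isomorphism \<open>n \<mapsto> n - 1\<close>. This
  applies to all row and column indices, to the parameter \<open>k\<close> of a warping operation, and to the
  values of \<open>ev_size\<close>, \<open>ev_rows\<close>, \<open>ev_cols\<close> (so \<open>ev_rows X\<close> is the 0-based index of row number
  rows(X)). The formulas below are unchanged by this shift. Pairs of indices carry the product
  order of \<^theory>\<open>HOL-Library.Product_Order\<close>.

  The module of \<open>d\<close>-tuples over the integral domain \<open>'a\<close> is \<open>'a ^ 'd\<close> with \<open>d = CARD('d)\<close>.
\<close>

subsection \<open>Eventually constant functions\<close>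

definition evC :: "(nat \<times> nat \<Rightarrow> 'a ^ 'd) set" where
  "evC = {X. \<exists>n. X constant_on {i. \<not> i \<le> n}}"

definition evZ :: "(nat \<times> nat \<Rightarrow> 'a::zero ^ 'd) set" where
  "evZ = {Z. finite {i. Z i \<noteq> 0}}"

definition ev_size :: "(nat \<times> nat \<Rightarrow> 'a ^ 'd) \<Rightarrow> nat \<times> nat" where
  "ev_size X = (LEAST n. X constant_on {i. \<not> i \<le> n})"

definition ev_rows :: "(nat \<times> nat \<Rightarrow> 'a ^ 'd) \<Rightarrow> nat" where
  "ev_rows X = fst (ev_size X)"

definition ev_cols :: "(nat \<times> nat \<Rightarrow> 'a ^ 'd) \<Rightarrow> nat" where
  "ev_cols X = snd (ev_size X)"


subsection \<open>Warping\<close>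

text \<open>The two axes \<open>Axis1\<close>, \<open>Axis2\<close> are the values \<open>a = 1\<close> (rows) and \<open>a = 2\<close> (columns).\<close>

datatype axis = Axis1 | Axis2

fun coord :: "axis \<Rightarrow> nat \<times> nat \<Rightarrow> nat" where
  "coord Axis1 i = fst i"
| "coord Axis2 i = snd i"

fun unit_index :: "axis \<Rightarrow> nat \<times> nat" where
  "unit_index Axis1 = (1, 0)"
| "unit_index Axis2 = (0, 1)"

definition warp :: "axis \<Rightarrow> nat \<Rightarrow> (nat \<times> nat \<Rightarrow> 'a ^ 'd) \<Rightarrow> (nat \<times> nat \<Rightarrow> 'a ^ 'd)" where
  "warp a k X = (\<lambda>i. if coord a i \<le> k then X i else X (i - unit_index a))"

definition warps_to :: "(nat \<times> nat \<Rightarrow> 'a ^ 'd) \<Rightarrow> (nat \<times> nat \<Rightarrow> 'a ^ 'd) \<Rightarrow> bool" where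
  "warps_to = (\<lambda>X Y. \<exists>a k. Y = warp a k X)\<^sup>*\<^sup>*"

definition no_repeats :: "(nat \<times> nat \<Rightarrow> 'a ^ 'd) \<Rightarrow> bool" where
  "no_repeats B \<longleftrightarrow>
     (\<forall>i < ev_rows B. (\<lambda>j. B (i, j)) \<noteq> (\<lambda>j. B (i + 1, j))) \<and>
     (\<forall>j < ev_cols B. (\<lambda>i. B (i, j)) \<noteq> (\<lambda>i. B (i, j + 1)))"

definition NF_warp :: "(nat \<times> nat \<Rightarrow> 'a ^ 'd) \<Rightarrow> (nat \<times> nat \<Rightarrow> 'a ^ 'd)" where
  "NF_warp A = (THE B. B \<in> evC \<and> warps_to B A \<and> no_repeats B)"


subsection \<open>Differences and sums\<close>

definition delta :: "(nat \<times> nat \<Rightarrow> 'a::ab_group_add ^ 'd) \<Rightarrow> (nat \<times> nat \<Rightarrow> 'a ^ 'd)" where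
  "delta X = (\<lambda>(i, j). X (i + 1, j + 1) - X (i + 1, j) - X (i, j + 1) + X (i, j))"

definition ker_delta :: "(nat \<times> nat \<Rightarrow> 'a::ab_group_add ^ 'd) set" where
  "ker_delta = {X \<in> evC. delta X = (\<lambda>_. 0)}"

text \<open>For \<open>Z \<in> evZ\<close> the double series has finitely many non-zero terms; only these are summed.\<close>

definition varsigma :: "(nat \<times> nat \<Rightarrow> 'a::ab_group_add ^ 'd) \<Rightarrow> (nat \<times> nat \<Rightarrow> 'a ^ 'd)" where
  "varsigma Z = (\<lambda>(i, j). \<Sum>(s, t) | i \<le> s \<and> j \<le> t \<and> Z (s, t) \<noteq> 0. Z (s, t))"

definition NF_ker_delta :: "(nat \<times> nat \<Rightarrow> 'a::ab_group_add ^ 'd) \<Rightarrow> (nat \<times> nat \<Rightarrow> 'a ^ 'd)" where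
  "NF_ker_delta = varsigma \<circ> delta"

definition NF_sim :: "(nat \<times> nat \<Rightarrow> 'a::ab_group_add ^ 'd) \<Rightarrow> (nat \<times> nat \<Rightarrow> 'a ^ 'd)" where
  "NF_sim = NF_ker_delta \<circ> NF_warp"

definition sim ::
  "(nat \<times> nat \<Rightarrow> 'a::ab_group_add ^ 'd) \<Rightarrow> (nat \<times> nat \<Rightarrow> 'a ^ 'd) \<Rightarrow> bool" where
  "sim = (\<lambda>X Y. X \<in> evC \<and> Y \<in> evC \<and> (X - Y \<in> ker_delta \<or> NF_warp X = NF_warp Y))\<^sup>+\<^sup>+"


subsection \<open>Matrix compositions and the two-parameter sums signature\<close>

text \<open>
  The free commutative monoid on the letters \<open>'d\<close> is \<^typ>\<open>'d multiset\<close>, with \<open>+\<close> for its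
  operation and \<open>{#}\<close> for its neutral element. The empty composition is \<^const>\<open>None\<close>.
\<close>

definition Cmp :: "'d multiset mat option set" where
  "Cmp = insert None (Some ` {a. dim_row a \<ge> 1 \<and> dim_col a \<ge> 1 \<and>
     (\<forall>s < dim_row a. \<exists>t < dim_col a. a $$ (s, t) \<noteq> {#}) \<and>
     (\<forall>t < dim_col a. \<exists>s < dim_row a. a $$ (s, t) \<noteq> {#})})"

definition monomial_eval :: "'a::comm_monoid_mult ^ 'd \<Rightarrow> 'd multiset \<Rightarrow> 'a" where
  "monomial_eval z \<mu> = (\<Prod>j \<in># \<mu>. vec_nth z j)"

definition increasing_seqs :: "nat \<Rightarrow> nat list set" where
  "increasing_seqs m = {\<iota>. length \<iota> = m \<and> sorted_wrt (<) \<iota>}"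

definition SS_term ::
  "(nat \<times> nat \<Rightarrow> 'a::idom ^ 'd) \<Rightarrow> 'd multiset mat \<Rightarrow> nat list \<Rightarrow> nat list \<Rightarrow> 'a" where
  "SS_term Z a \<iota> \<kappa> =
     (\<Prod>s < dim_row a. \<Prod>t < dim_col a. monomial_eval (Z (\<iota> ! s, \<kappa> ! t)) (a $$ (s, t)))"

text \<open>
  For \<open>Z \<in> evZ\<close> and a non-empty composition \<open>a\<close> only finitely many terms are non-zero, since
  every row and every column of \<open>a\<close> has an entry other than \<open>{#}\<close>; only these are summed.
\<close>

definition SS_coeff ::
  "(nat \<times> nat \<Rightarrow> 'a::idom ^ 'd) \<Rightarrow> 'd multiset mat option \<Rightarrow> 'a" where
  "SS_coeff Z c = (case c of
     None \<Rightarrow> 1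
   | Some a \<Rightarrow> \<Sum>(\<iota>, \<kappa>) | \<iota> \<in> increasing_seqs (dim_row a) \<and>
         \<kappa> \<in> increasing_seqs (dim_col a) \<and> SS_term Z a \<iota> \<kappa> \<noteq> 0. SS_term Z a \<iota> \<kappa>)"

definition SS ::
  "(nat \<times> nat \<Rightarrow> 'a::idom ^ 'd) \<Rightarrow> ('d multiset mat option \<Rightarrow> 'a)" where
  "SS Z = restrict (SS_coeff Z) Cmp"

end

theory Submission
  imports Defs
begin

text \<open>
  A warping repeats a row or a column of \<open>X\<close>, so it inserts a zero row or a zero column into
  \<open>delta X\<close>. The signature does not see these insertions (\<open>SS_insert_zeros\<close>), because every row
  and every column of a composition contains a non-trivial monomial, which vanishes at \<open>0\<close>. Nor
  does \<open>delta\<close> see additive constants. Hence equivalent functions have the same signature.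

  Conversely, if \<open>X\<close> is in warping normal form, then \<open>delta X\<close> fills a rectangle of some size
  \<open>m \<times> n\<close> with no zero row and no zero column inside it (\<open>no_repeats_delta_tight\<close>), and the
  signature determines such an array \<open>Z\<close> (\<open>tight_SS_inject\<close>). Indeed, coefficients at compositions
  with more than \<open>m\<close> rows or more than \<open>n\<close> columns vanish, and at a composition of size exactly
  \<open>m \<times> n\<close> the sum has a single term, the product of the monomials in the entries of \<open>Z\<close>. Choosing
  one letter at each non-zero entry gives such a composition \<open>a\<close> with a non-zero coefficient; so the
  size is known. Adding one more letter \<open>l\<close> at position \<open>(s, t)\<close> to \<open>a\<close> multiplies the coefficient
  by component \<open>l\<close> of \<open>Z (s, t)\<close>, and in an integral domain this factor can be recovered by
  cancellation.

  Uniqueness of the warping normal form is a consequence of the same rigidity: two normal forms of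
  \<open>A\<close> share the signature of \<open>delta A\<close>, hence their differences agree, hence they differ by
  a constant; this constant is zero because warping keeps the value taken far out. Existence is
  by deleting repeated rows and columns. Everything then reduces to the equivalence of
  \<open>delta (NF_warp X) = delta (NF_warp Y)\<close> with each of the three conditions.
\<close>

section \<open>Eventually constant functions\<close>

text \<open>The value \<open>c\<close> is kept as a parameter since warping preserves it while the box changes.\<close>
definition const_outside :: "nat \<times> nat \<Rightarrow> 'a ^ 'd \<Rightarrow> (nat \<times> nat \<Rightarrow> 'a ^ 'd) \<Rightarrow> bool" where
  "const_outside n c X \<longleftrightarrow> (\<forall>i. \<not> i \<le> n \<longrightarrow> X i = c)"

lemma const_outsideD: "const_outside n c X \<Longrightarrow> fst n < i \<or> snd n < j \<Longrightarrow> X (i, j) = c"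
  by (auto simp: const_outside_def less_eq_prod_def)

lemma constant_on_iff_const_outside: "X constant_on {i. \<not> i \<le> n} \<longleftrightarrow> (\<exists>c. const_outside n c X)"
  by (auto simp: constant_on_def const_outside_def)

lemma evC_iff_const_outside: "X \<in> evC \<longleftrightarrow> (\<exists>n c. const_outside n c X)"
  by (simp add: evC_def constant_on_iff_const_outside)

lemma const_outside_value_unique:
  assumes "const_outside n c X" and "const_outside m c' X"
  shows "c = c'"
  using const_outsideD[OF assms(1), of "Suc (fst n + fst m)" 0]
        const_outsideD[OF assms(2), of "Suc (fst n + fst m)" 0] by simp

lemma const_outside_inf:
  assumes "const_outside (r, t) c X" and "const_outside (r', t') c' X"
  shows "const_outside (min r r', min t t') c X"
proof -
  have "c' = c" using const_outside_value_unique[OF assms] by simp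
  then show ?thesis using assms by (auto simp: const_outside_def less_eq_prod_def)
qed

lemma const_outside_swap:
  "const_outside n c (X \<circ> prod.swap) \<longleftrightarrow> const_outside (prod.swap n) c X"
  by (cases n) (auto simp: const_outside_def less_eq_prod_def)

lemma evC_swap: "X \<circ> prod.swap \<in> evC \<longleftrightarrow> X \<in> evC"
  unfolding evC_iff_const_outside const_outside_swap by (metis swap_swap)

text \<open>
  The boxes outside of which \<open>X\<close> is constant are closed under componentwise minimum, because the
  complements of two boxes meet and so carry the same constant. Hence the product order, although
  only partial, has a least such box.
\<close>
lemma ev_size_least:
  assumes "X \<in> evC"
  obtains c where "const_outside (ev_size X) c X"
    and "\<And>n c'. const_outside n c' X \<Longrightarrow> ev_size X \<le> n"
proof -
  define P where "P r t \<longleftrightarrow> (\<exists>c. const_outside (r, t) c X)" for r t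
  obtain r0 t0 where P0: "P r0 t0"
    using assms unfolding evC_iff_const_outside P_def by force
  define r where "r = (LEAST r. \<exists>t. P r t)"
  define t where "t = (LEAST t. \<exists>r. P r t)"
  obtain t1 where t1: "P r t1" using LeastI_ex[of "\<lambda>r. \<exists>t. P r t"] P0 unfolding r_def by blast
  obtain r1 where r1: "P r1 t" using LeastI_ex[of "\<lambda>t. \<exists>r. P r t"] P0 unfolding t_def by blast
  have lower: "r \<le> r'" "t \<le> t'" if "P r' t'" for r' t'
    using that unfolding r_def t_def by (auto intro: Least_le)
  have "P (min r r1) (min t1 t)"
    using t1 r1 const_outside_inf unfolding P_def by blast
  then have Prt: "P r t" using lower(1)[OF r1] lower(2)[OF t1] by (simp add: min_def split: if_splits)
  have size: "ev_size X = (r, t)"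
    unfolding ev_size_def constant_on_iff_const_outside
  proof (rule Least_equality)
    show "\<exists>c. const_outside (r, t) c X" using Prt by (simp add: P_def)
    show "(r, t) \<le> y" if "\<exists>c. const_outside y c X" for y
      using that lower[of "fst y" "snd y"] by (auto simp: P_def less_eq_prod_def)
  qed
  show ?thesis
  proof -
    obtain c where "const_outside (r, t) c X" using Prt P_def by auto
    moreover have "(r, t) \<le> n" if "const_outside n c' X" for n c'
      using that lower[of "fst n" "snd n"] by (auto simp: P_def less_eq_prod_def)
    ultimately show ?thesis using that size by simp
  qed
qed

lemma ev_size_swap:
  assumes "X \<in> evC"
  shows "ev_size (X \<circ> prod.swap) = prod.swap (ev_size X)"
proof -
  obtain c where c: "const_outside (ev_size X) c X"
    and l: "\<And>n c'. const_outside n c' X \<Longrightarrow> ev_size X \<le> n"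
    using ev_size_least[OF assms] by blast
  have "X \<circ> prod.swap \<in> evC" using assms by (simp add: evC_swap)
  then obtain c' where c': "const_outside (ev_size (X \<circ> prod.swap)) c' (X \<circ> prod.swap)"
    and l': "\<And>n c'. const_outside n c' (X \<circ> prod.swap) \<Longrightarrow> ev_size (X \<circ> prod.swap) \<le> n"
    using ev_size_least by metis
  have "ev_size X \<le> prod.swap (ev_size (X \<circ> prod.swap))"
    using l c' const_outside_swap by blast
  moreover have "ev_size (X \<circ> prod.swap) \<le> prod.swap (ev_size X)"
    using l' c const_outside_swap by (metis swap_swap)
  ultimately show ?thesis by (auto simp: less_eq_prod_def prod_eq_iff)
qed

lemma no_repeats_swap:
  assumes "X \<in> evC"
  shows "no_repeats (X \<circ> prod.swap) \<longleftrightarrow> no_repeats X"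
  by (auto simp: no_repeats_def ev_rows_def ev_cols_def ev_size_swap[OF assms])


section \<open>The difference operator\<close>

lemma delta_swap: "delta (X \<circ> prod.swap) = delta X \<circ> prod.swap"
  by (auto simp: delta_def fun_eq_iff)

text \<open>
  The double sum telescopes. This one identity yields that \<open>delta X\<close> determines \<open>X\<close> up to the
  constant \<open>c\<close>, and that \<open>NF_ker_delta\<close> subtracts the eventual value.
\<close>
lemma varsigma_delta:
  fixes X :: "nat \<times> nat \<Rightarrow> 'a::ab_group_add ^ 'd"
  assumes "const_outside n c X"
  shows "varsigma (delta X) = (\<lambda>i. X i - c)"
proof (rule ext, clarify)
  fix i j
  \<comment> \<open>A corner beyond both the box \<open>n\<close> and the summation start \<open>(i, j)\<close>, so that no range is empty.\<close>
  define r where "r = Suc (i + fst n)"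
  define t where "t = Suc (j + snd n)"
  have far: "X (i', j') = c" if "r \<le> i' \<or> t \<le> j'" for i' j'
    using const_outsideD[OF assms, of i' j'] that by (auto simp: r_def t_def)
  have "varsigma (delta X) (i, j) =
      (\<Sum>(s, t) | i \<le> s \<and> j \<le> t \<and> delta X (s, t) \<noteq> 0. delta X (s, t))"
    by (simp add: varsigma_def)
  also have "\<dots> = (\<Sum>(s, t') \<in> {i..<r} \<times> {j..<t}. delta X (s, t'))"
  proof (rule sum.mono_neutral_left)
    have "s < r \<and> t' < t" if "delta X (s, t') \<noteq> 0" for s t'
      using that far by (auto simp: delta_def not_le[symmetric])
    then show "{(s, t). i \<le> s \<and> j \<le> t \<and> delta X (s, t) \<noteq> 0} \<subseteq> {i..<r} \<times> {j..<t}"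
      by auto
  qed auto
  also have "\<dots> = (\<Sum>s = i..<r. \<Sum>t' = j..<t. delta X (s, t'))"
    by (simp add: sum.cartesian_product)
  also have "\<dots> = (\<Sum>s = i..<r. (X (Suc s, t) - X (s, t)) - (X (Suc s, j) - X (s, j)))"
  proof (rule sum.cong[OF refl])
    fix s
    have "(\<Sum>t' = j..<t. delta X (s, t')) =
        (\<Sum>t' = j..<t. (X (Suc s, Suc t') - X (s, Suc t')) - (X (Suc s, t') - X (s, t')))"
      by (rule sum.cong) (auto simp: delta_def algebra_simps)
    also have "\<dots> = (X (Suc s, t) - X (s, t)) - (X (Suc s, j) - X (s, j))"
      using sum_Suc_diff'[of j t "\<lambda>t'. X (Suc s, t') - X (s, t')"] by (simp add: t_def)
    finally show "(\<Sum>t' = j..<t. delta X (s, t')) = \<dots>" .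
  qed
  also have "\<dots> = (\<Sum>s = i..<r. (X (Suc s, t) - X (Suc s, j)) - (X (s, t) - X (s, j)))"
    by (rule sum.cong) (auto simp: algebra_simps)
  also have "\<dots> = (X (r, t) - X (r, j)) - (X (i, t) - X (i, j))"
    using sum_Suc_diff'[of i r "\<lambda>s. X (s, t) - X (s, j)"] by (simp add: r_def)
  also have "\<dots> = X (i, j) - c" by (simp add: far)
  finally show "varsigma (delta X) (i, j) = X (i, j) - c" .
qed

lemma delta_diff: "delta (X - Y) = delta X - delta Y"
  by (auto simp: delta_def fun_eq_iff)

lemma diff_in_evC:
  assumes "X \<in> evC" and "Y \<in> evC"
  shows "X - Y \<in> evC"
proof -
  obtain n c m c' where X: "const_outside n c X" and Y: "const_outside m c' Y"
    using assms by (auto simp: evC_iff_const_outside)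
  have "const_outside (fst n + fst m, snd n + snd m) (c - c') (X - Y)"
    using X Y by (auto simp: const_outside_def less_eq_prod_def)
  then show ?thesis by (auto simp: evC_iff_const_outside)
qed

lemma diff_in_ker_delta_iff:
  assumes "X \<in> evC" and "Y \<in> evC"
  shows "X - Y \<in> ker_delta \<longleftrightarrow> delta X = delta Y"
  using diff_in_evC[OF assms] by (auto simp: ker_delta_def delta_diff fun_eq_iff)

lemma NF_ker_delta_eq_iff:
  assumes "X \<in> evC" and "Y \<in> evC"
  shows "NF_ker_delta X = NF_ker_delta Y \<longleftrightarrow> delta X = delta Y"
proof
  assume eq: "NF_ker_delta X = NF_ker_delta Y"
  have "delta (NF_ker_delta W) = delta W" if "W \<in> evC" for W :: "nat \<times> nat \<Rightarrow> 'a ^ 'b"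
    using that by (auto simp: evC_iff_const_outside NF_ker_delta_def varsigma_delta)
      (auto simp: delta_def fun_eq_iff)
  then show "delta X = delta Y" using eq assms by metis
qed (simp add: NF_ker_delta_def)


section \<open>Warping\<close>

text \<open>Transposition exchanges the two axes, so that arguments are needed for rows only.\<close>
lemma warp_Axis2_conv_Axis1: "warp Axis2 k X = warp Axis1 k (X \<circ> prod.swap) \<circ> prod.swap"
  by (auto simp: warp_def fun_eq_iff)

lemma const_outside_warp:
  assumes "const_outside n c X"
  shows "const_outside (Suc (fst n), Suc (snd n)) c (warp a k X)"
  by (cases a; force simp: const_outside_def[of "(Suc (fst n), Suc (snd n))"] warp_def
      less_eq_prod_def intro: const_outsideD[OF assms])

lemma warps_to_refl: "warps_to X X"
  by (simp add: warps_to_def)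

lemma warps_to_warp:
  assumes "warps_to X Y"
  shows "warps_to X (warp a k Y)"
  using assms unfolding warps_to_def by (rule rtranclp.rtrancl_into_rtrancl) blast

lemma const_outside_warps_to:
  assumes "warps_to X Y" and "const_outside n c X"
  shows "\<exists>m. const_outside m c Y"
  using assms(1) unfolding warps_to_def
proof (induction rule: rtranclp_induct)
  case base
  show ?case using assms(2) by blast
next
  case (step V W)
  then show ?case using const_outside_warp by metis
qed

text \<open>Deleting row \<open>k + 1\<close>, a copy of row \<open>k\<close>, undoes a warping and shrinks the box.\<close>
lemma unwarp_repeated_row:
  assumes A: "const_outside n c A" and k: "k < fst n"
    and rep: "\<And>j. A (k, j) = A (k + 1, j)"
  obtains B where "const_outside (fst n - 1, snd n) c B" and "A = warp Axis1 k B"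
proof
  let ?B = "\<lambda>(i, j). A (if i \<le> k then i else i + 1, j)"
  show "const_outside (fst n - 1, snd n) c ?B"
    using k by (auto simp: const_outside_def less_eq_prod_def intro!: const_outsideD[OF A])
  show "A = warp Axis1 k ?B"
    using rep by (auto simp: warp_def fun_eq_iff le_Suc_eq not_le elim!: less_natE)
qed

lemma unwarp_repeat:
  assumes A: "const_outside n c A" and rep: "\<not> no_repeats A"
  obtains m a k B where "fst m + snd m < fst n + snd n" and "const_outside m c B"
    and "A = warp a k B"
proof -
  have "ev_size A \<le> n"
    using A ev_size_least[of A] by (metis evC_iff_const_outside)
  then consider (row) k where "k < fst n" "\<And>j. A (k, j) = A (k + 1, j)"
    | (col) k where "k < snd n" "\<And>i. A (i, k) = A (i, k + 1)"
    using rep unfolding no_repeats_def ev_rows_def ev_cols_def less_eq_prod_def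
    by (metis order_less_le_trans)
  then show ?thesis
  proof cases
    case row
    then obtain B where "const_outside (fst n - 1, snd n) c B" "A = warp Axis1 k B"
      using unwarp_repeated_row[OF A] by metis
    then show ?thesis using that[of "(fst n - 1, snd n)"] row(1) by auto
  next
    case col
    have "const_outside (prod.swap n) c (A \<circ> prod.swap)"
      using A by (simp add: const_outside_swap)
    then obtain B where B: "const_outside (snd n - 1, fst n) c B"
      and "A \<circ> prod.swap = warp Axis1 k B"
      using unwarp_repeated_row[of "prod.swap n" c "A \<circ> prod.swap" k] col by auto
    then have "A = warp Axis1 k B \<circ> prod.swap" by (metis comp_assoc comp_id swap_comp_swap)
    also have "\<dots> = warp Axis2 k (B \<circ> prod.swap)"
      by (simp add: warp_Axis2_conv_Axis1 comp_assoc)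
    finally show ?thesis
      using that[of "(fst n, snd n - 1)" "B \<circ> prod.swap"] B col(1)
      by (auto simp: const_outside_swap)
  qed
qed

text \<open>Each deletion of a repeated row or column lowers the semiperimeter of the box.\<close>
lemma warp_normal_form_exists:
  assumes "A \<in> evC"
  shows "\<exists>B\<in>evC. warps_to B A \<and> no_repeats B"
proof -
  obtain n c where "const_outside n c A" using assms by (auto simp: evC_iff_const_outside)
  then show ?thesis
  proof (induction "fst n + snd n" arbitrary: n A rule: less_induct)
    case less
    show ?case
    proof (cases "no_repeats A")
      case True
      then show ?thesis
        using less.prems warps_to_refl evC_iff_const_outside by blast
    next
      case False
      then obtain m a k A' where "fst m + snd m < fst n + snd n" "const_outside m c A'"
        and A: "A = warp a k A'"
        using unwarp_repeat[OF less.prems] by metis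
      then obtain B where "B \<in> evC" "warps_to B A'" "no_repeats B"
        using less.hyps by blast
      then show ?thesis using A warps_to_warp by blast
    qed
  qed
qed


section \<open>The signature under insertion of zero rows and columns\<close>

lemma monomial_eval_zero: "\<mu> \<noteq> {#} \<Longrightarrow> monomial_eval (0 :: 'a::idom ^ 'd) \<mu> = 0"
  by (auto simp: monomial_eval_def nonempty_has_size)

lemma Some_in_Cmp_iff:
  "Some a \<in> Cmp \<longleftrightarrow> 1 \<le> dim_row a \<and> 1 \<le> dim_col a \<and>
     (\<forall>s < dim_row a. \<exists>t < dim_col a. a $$ (s, t) \<noteq> {#}) \<and>
     (\<forall>t < dim_col a. \<exists>s < dim_row a. a $$ (s, t) \<noteq> {#})"
  unfolding Cmp_def by (simp add: image_iff)

text \<open>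
  This is where the condition on rows and columns of a composition enters: a non-trivial monomial
  vanishes at \<open>0\<close>, so a selected row or column of zeros would make the term vanish.
\<close>
lemma SS_term_nonzero_meets_support:
  assumes "Some a \<in> Cmp" and "SS_term Z a \<iota> \<kappa> \<noteq> 0"
  shows "s < dim_row a \<Longrightarrow> \<exists>t < dim_col a. Z (\<iota> ! s, \<kappa> ! t) \<noteq> 0"
    and "t < dim_col a \<Longrightarrow> \<exists>s < dim_row a. Z (\<iota> ! s, \<kappa> ! t) \<noteq> 0"
proof -
  have nz: "monomial_eval (Z (\<iota> ! s, \<kappa> ! t)) (a $$ (s, t)) \<noteq> 0"
    if "s < dim_row a" "t < dim_col a" for s t
    using assms(2) that by (auto simp: SS_term_def)
  then have "Z (\<iota> ! s, \<kappa> ! t) \<noteq> 0"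
    if "s < dim_row a" "t < dim_col a" "a $$ (s, t) \<noteq> {#}" for s t
    using that monomial_eval_zero by metis
  then show "s < dim_row a \<Longrightarrow> \<exists>t < dim_col a. Z (\<iota> ! s, \<kappa> ! t) \<noteq> 0"
    and "t < dim_col a \<Longrightarrow> \<exists>s < dim_row a. Z (\<iota> ! s, \<kappa> ! t) \<noteq> 0"
    using assms(1) unfolding Some_in_Cmp_iff by blast+
qed

lemma increasing_seqs_map_iff:
  assumes "strict_mono f"
  shows "map f xs \<in> increasing_seqs m \<longleftrightarrow> xs \<in> increasing_seqs m"
  using assms by (simp add: increasing_seqs_def sorted_wrt_map strict_mono_less)

text \<open>
  Here \<open>Z'\<close> arises from \<open>Z\<close> by moving row \<open>i\<close> to \<open>f i\<close> and column \<open>j\<close> to \<open>g j\<close> and filling the gaps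
  with zeros. Non-zero terms never select a filled gap, so index sequences for \<open>Z'\<close> are
  exactly the images of those for \<open>Z\<close>.
\<close>
lemma SS_insert_zeros:
  fixes Z Z' :: "nat \<times> nat \<Rightarrow> 'a::idom ^ 'd"
  assumes f: "strict_mono f" and g: "strict_mono g"
    and Z: "\<And>i j. Z' (f i, g j) = Z (i, j)"
    and zero: "\<And>i j. i \<notin> range f \<or> j \<notin> range g \<Longrightarrow> Z' (i, j) = 0"
  shows "SS Z' = SS Z"
proof -
  have "SS_coeff Z' (Some a) = SS_coeff Z (Some a)" if a: "Some a \<in> Cmp" for a
  proof -
    let ?S = "\<lambda>Z. {(\<iota>, \<kappa>). \<iota> \<in> increasing_seqs (dim_row a) \<and>
      \<kappa> \<in> increasing_seqs (dim_col a) \<and> SS_term Z a \<iota> \<kappa> \<noteq> 0}"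
    let ?h = "\<lambda>(\<iota>, \<kappa>). (map f \<iota>, map g \<kappa>)"
    have term_eq: "SS_term Z' a (map f \<iota>) (map g \<kappa>) = SS_term Z a \<iota> \<kappa>"
      if "\<iota> \<in> increasing_seqs (dim_row a)" "\<kappa> \<in> increasing_seqs (dim_col a)" for \<iota> \<kappa>
      using that by (simp add: SS_term_def increasing_seqs_def Z)
    have bij: "bij_betw ?h (?S Z) (?S Z')"
      unfolding bij_betw_def
    proof
      have "inj f" "inj g" using f g by (auto simp: strict_mono_imp_inj_on)
      then show "inj_on ?h (?S Z)" by (auto intro!: inj_onI simp: inj_map_eq_map)
      show "?h ` ?S Z = ?S Z'"
      proof
        show "?h ` ?S Z \<subseteq> ?S Z'"
          using f g by (auto simp: increasing_seqs_map_iff term_eq)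
        show "?S Z' \<subseteq> ?h ` ?S Z"
        proof clarify
          fix \<iota> \<kappa>
          assume \<iota>: "\<iota> \<in> increasing_seqs (dim_row a)" and \<kappa>: "\<kappa> \<in> increasing_seqs (dim_col a)"
            and nz: "SS_term Z' a \<iota> \<kappa> \<noteq> 0"
          have supp: "i \<in> range f \<and> j \<in> range g" if "Z' (i, j) \<noteq> 0" for i j
            using zero that by blast
          have "set \<iota> \<subseteq> range f"
            using SS_term_nonzero_meets_support(1)[OF a nz] \<iota> supp
            by (fastforce simp: increasing_seqs_def in_set_conv_nth)
          then obtain \<iota>' where \<iota>': "\<iota> = map f \<iota>'" by (metis ex_map_conv rangeE subsetD)
          have "set \<kappa> \<subseteq> range g"
            using SS_term_nonzero_meets_support(2)[OF a nz] \<kappa> supp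
            by (fastforce simp: increasing_seqs_def in_set_conv_nth)
          then obtain \<kappa>' where \<kappa>': "\<kappa> = map g \<kappa>'" by (metis ex_map_conv rangeE subsetD)
          show "(\<iota>, \<kappa>) \<in> ?h ` ?S Z"
          proof (rule image_eqI)
            show "(\<iota>, \<kappa>) = ?h (\<iota>', \<kappa>')" by (simp add: \<iota>' \<kappa>')
            have "\<iota>' \<in> increasing_seqs (dim_row a)" "\<kappa>' \<in> increasing_seqs (dim_col a)"
              using \<iota> \<kappa> by (simp_all add: \<iota>' \<kappa>' increasing_seqs_map_iff f g)
            then show "(\<iota>', \<kappa>') \<in> ?S Z" using nz by (simp add: \<iota>' \<kappa>' term_eq)
          qed
        qed
      qed
    qed
    have "(\<Sum>(\<iota>, \<kappa>)\<in>?S Z'. SS_term Z' a \<iota> \<kappa>) =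
        (\<Sum>x\<in>?S Z. (\<lambda>(\<iota>, \<kappa>). SS_term Z' a \<iota> \<kappa>) (?h x))"
      by (rule sum.reindex_bij_betw[OF bij, symmetric])
    also have "\<dots> = (\<Sum>(\<iota>, \<kappa>)\<in>?S Z. SS_term Z a \<iota> \<kappa>)"
      by (rule sum.cong) (auto simp: term_eq)
    finally show ?thesis by (simp add: SS_coeff_def)
  qed
  then have "SS_coeff Z' c = SS_coeff Z c" if "c \<in> Cmp" for c
    using that by (cases c) (auto simp: SS_coeff_def)
  then show ?thesis by (auto simp: SS_def intro!: restrict_ext)
qed

text \<open>Rows \<open>k\<close> and \<open>k + 1\<close> of the warped function agree, so its difference has a new zero row \<open>k\<close>.\<close>
lemma SS_delta_warp:
  fixes X :: "nat \<times> nat \<Rightarrow> 'a::idom ^ 'd"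
  shows "SS (delta (warp a k X)) = SS (delta X)"
proof -
  define f where "f i = (if i < k then i else Suc i)" for i
  have f: "strict_mono f" by (auto simp: strict_mono_def f_def)
  have range: "i = k" if "i \<notin> range f" for i
  proof (rule ccontr)
    assume "i \<noteq> k"
    then have "i = f (if i < k then i else i - 1)" by (auto simp: f_def)
    then show False using that by blast
  qed
  have row: "delta (warp Axis1 k W) (f i, j) = delta W (i, j)"
    "delta (warp Axis1 k W) (k, j) = 0" for W :: "nat \<times> nat \<Rightarrow> 'a ^ 'd" and i j
    by (auto simp: delta_def warp_def f_def)
  show ?thesis
  proof (cases a)
    case Axis1
    show ?thesis
      unfolding Axis1
      by (rule SS_insert_zeros[OF f strict_mono_id]) (use row range in auto)
  next
    case Axis2
    show ?thesis
      unfolding Axis2 warp_Axis2_conv_Axis1 delta_swap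
      by (rule SS_insert_zeros[OF strict_mono_id f]) (use row range delta_swap[of X] in auto)
  qed
qed

lemma SS_delta_warps_to:
  fixes X :: "nat \<times> nat \<Rightarrow> 'a::idom ^ 'd"
  assumes "warps_to X Y"
  shows "SS (delta Y) = SS (delta X)"
  using assms unfolding warps_to_def
  by (induction rule: rtranclp_induct) (auto simp: SS_delta_warp)


section \<open>The signature determines arrays without zero rows and columns\<close>

text \<open>
  The shape of \<open>delta X\<close> for \<open>X\<close> in warping normal form: the support fits into the rectangle and
  touches each of its rows and columns, so \<open>m\<close> and \<open>n\<close> are determined by \<open>Z\<close>.
\<close>
definition tight :: "nat \<Rightarrow> nat \<Rightarrow> (nat \<times> nat \<Rightarrow> 'a::zero ^ 'd) \<Rightarrow> bool" where
  "tight m n Z \<longleftrightarrow> (\<forall>i j. Z (i, j) \<noteq> 0 \<longrightarrow> i < m \<and> j < n) \<and>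
     (\<forall>i < m. \<exists>j < n. Z (i, j) \<noteq> 0) \<and> (\<forall>j < n. \<exists>i < m. Z (i, j) \<noteq> 0)"

lemma tightD:
  assumes "tight m n Z"
  shows "Z (i, j) \<noteq> 0 \<Longrightarrow> i < m \<and> j < n"
    and "i < m \<Longrightarrow> \<exists>j < n. Z (i, j) \<noteq> 0"
    and "j < n \<Longrightarrow> \<exists>i < m. Z (i, j) \<noteq> 0"
proof -
  note conjs = assms[unfolded tight_def]
  show "Z (i, j) \<noteq> 0 \<Longrightarrow> i < m \<and> j < n"
    using conjunct1[OF conjs] by blast
  show "i < m \<Longrightarrow> \<exists>j < n. Z (i, j) \<noteq> 0"
    using conjunct1[OF conjunct2[OF conjs]] by blast
  show "j < n \<Longrightarrow> \<exists>i < m. Z (i, j) \<noteq> 0"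
    using conjunct2[OF conjunct2[OF conjs]] by blast
qed

lemma increasing_seq_below:
  assumes "xs \<in> increasing_seqs m" and "set xs \<subseteq> {..<n}"
  shows "m \<le> n" and "m = n \<Longrightarrow> xs = [0..<n]"
proof -
  have d: "distinct xs" "sorted xs" and l: "length xs = m"
    using assms(1) by (auto simp: increasing_seqs_def strict_sorted_iff)
  have c: "card (set xs) = m" using d l by (simp add: distinct_card)
  then show "m \<le> n" using card_mono[OF _ assms(2)] by simp
  assume "m = n"
  then have "set xs = {..<n}" using card_subset_eq[OF _ assms(2)] c by simp
  then show "xs = [0..<n]" using sorted_distinct_set_unique[OF d(2,1), of "[0..<n]"]
    by (simp add: atLeast0LessThan)
qed

lemma SS_term_nonzero_below:
  assumes Z: "tight m n Z" and a: "Some a \<in> Cmp" and nz: "SS_term Z a \<iota> \<kappa> \<noteq> 0"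
    and \<iota>: "\<iota> \<in> increasing_seqs (dim_row a)" and \<kappa>: "\<kappa> \<in> increasing_seqs (dim_col a)"
  shows "set \<iota> \<subseteq> {..<m}" and "set \<kappa> \<subseteq> {..<n}"
proof -
  show "set \<iota> \<subseteq> {..<m}"
  proof
    fix i
    assume "i \<in> set \<iota>"
    then obtain s where "s < dim_row a" "i = \<iota> ! s"
      using \<iota> by (auto simp: increasing_seqs_def in_set_conv_nth)
    then show "i \<in> {..<m}"
      using SS_term_nonzero_meets_support(1)[OF a nz] tightD(1)[OF Z] by blast
  qed
  show "set \<kappa> \<subseteq> {..<n}"
  proof
    fix i
    assume "i \<in> set \<kappa>"
    then obtain t where "t < dim_col a" "i = \<kappa> ! t"
      using \<kappa> by (auto simp: increasing_seqs_def in_set_conv_nth)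
    then show "i \<in> {..<n}"
      using SS_term_nonzero_meets_support(2)[OF a nz] tightD(1)[OF Z] by blast
  qed
qed

lemma SS_coeff_nonzero_size:
  assumes Z: "tight m n Z" and a: "Some a \<in> Cmp" and nz: "SS_coeff Z (Some a) \<noteq> 0"
  shows "dim_row a \<le> m" and "dim_col a \<le> n"
proof -
  have "\<exists>\<iota> \<kappa>. \<iota> \<in> increasing_seqs (dim_row a) \<and> \<kappa> \<in> increasing_seqs (dim_col a) \<and>
      SS_term Z a \<iota> \<kappa> \<noteq> 0"
  proof (rule ccontr)
    assume "\<not> ?thesis"
    then have "SS_coeff Z (Some a) = 0"
      unfolding SS_coeff_def option.case by (intro sum.neutral) auto
    then show False using nz by simp
  qed
  then obtain \<iota> \<kappa> where *: "\<iota> \<in> increasing_seqs (dim_row a)"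
    "\<kappa> \<in> increasing_seqs (dim_col a)" "SS_term Z a \<iota> \<kappa> \<noteq> 0" by blast
  show "dim_row a \<le> m"
    by (rule increasing_seq_below(1)[OF *(1)]) (rule SS_term_nonzero_below(1)[OF Z a *(3,1,2)])
  show "dim_col a \<le> n"
    by (rule increasing_seq_below(1)[OF *(2)]) (rule SS_term_nonzero_below(2)[OF Z a *(3,1,2)])
qed

text \<open>
  At full size there is only one way to choose \<open>m\<close> increasing rows below \<open>m\<close> and \<open>n\<close> increasing
  columns below \<open>n\<close>, so the coefficient is a single monomial in the entries.
\<close>
lemma SS_coeff_top:
  assumes Z: "tight m n Z" and a: "Some a \<in> Cmp" and dim: "dim_row a = m" "dim_col a = n"
  shows "SS_coeff Z (Some a) = (\<Prod>s<m. \<Prod>t<n. monomial_eval (Z (s, t)) (a $$ (s, t)))"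
proof -
  have "SS_coeff Z (Some a) = (\<Sum>(\<iota>, \<kappa>)\<in>{([0..<m], [0..<n])}. SS_term Z a \<iota> \<kappa>)"
    unfolding SS_coeff_def option.case
  proof (rule sum.mono_neutral_left)
    show "{(\<iota>, \<kappa>). \<iota> \<in> increasing_seqs (dim_row a) \<and> \<kappa> \<in> increasing_seqs (dim_col a) \<and>
        SS_term Z a \<iota> \<kappa> \<noteq> 0} \<subseteq> {([0..<m], [0..<n])}"
    proof
      fix x
      assume "x \<in> {(\<iota>, \<kappa>). \<iota> \<in> increasing_seqs (dim_row a) \<and>
        \<kappa> \<in> increasing_seqs (dim_col a) \<and> SS_term Z a \<iota> \<kappa> \<noteq> 0}"
      then obtain \<iota> \<kappa> where x: "x = (\<iota>, \<kappa>)" and seqs: "\<iota> \<in> increasing_seqs (dim_row a)"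
        "\<kappa> \<in> increasing_seqs (dim_col a)" and nz: "SS_term Z a \<iota> \<kappa> \<noteq> 0" by blast
      have "\<iota> = [0..<m]"
        using increasing_seq_below(2)[OF seqs(1)] SS_term_nonzero_below(1)[OF Z a nz seqs] dim
        by simp
      moreover have "\<kappa> = [0..<n]"
        using increasing_seq_below(2)[OF seqs(2)] SS_term_nonzero_below(2)[OF Z a nz seqs] dim
        by simp
      ultimately show "x \<in> {([0..<m], [0..<n])}" by (simp add: x)
    qed
  qed (auto simp: dim increasing_seqs_def sorted_wrt_upt)
  also have "\<dots> = (\<Prod>s<m. \<Prod>t<n. monomial_eval (Z (s, t)) (a $$ (s, t)))"
    by (auto simp: SS_term_def dim intro!: prod.cong)
  finally show ?thesis .
qed

text \<open>
  Put a letter at which \<open>Z (s, t)\<close> does not vanish at every non-zero entry, and the neutral element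
  elsewhere. Tightness makes this a composition, and the product of its factors is non-zero
  in an integral domain.
\<close>
lemma tight_top_composition:
  fixes Z :: "nat \<times> nat \<Rightarrow> 'a::idom ^ 'd"
  assumes Z: "tight m n Z" and "0 < m"
  obtains a where "Some a \<in> Cmp" "dim_row a = m" "dim_col a = n" "SS_coeff Z (Some a) \<noteq> 0"
proof -
  define \<mu> :: "'a ^ 'd \<Rightarrow> 'd multiset" where
    "\<mu> z = (if z = 0 then {#} else {#SOME l. vec_nth z l \<noteq> 0#})" for z
  define a where "a = mat m n (\<lambda>(s, t). \<mu> (Z (s, t)))"
  have "0 < n" using tightD(2)[OF Z \<open>0 < m\<close>] by auto
  have nz: "a $$ (s, t) \<noteq> {#}" if "Z (s, t) \<noteq> 0" for s t
    using that tightD(1)[OF Z that] by (simp add: a_def \<mu>_def)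
  have "\<exists>t < n. a $$ (s, t) \<noteq> {#}" if "s < m" for s
    using tightD(2)[OF Z that] nz by blast
  moreover have "\<exists>s < m. a $$ (s, t) \<noteq> {#}" if "t < n" for t
    using tightD(3)[OF Z that] nz by blast
  ultimately have a: "Some a \<in> Cmp"
    using \<open>0 < m\<close> \<open>0 < n\<close> by (simp add: Some_in_Cmp_iff a_def Suc_le_eq)
  have "monomial_eval z (\<mu> z) \<noteq> 0" for z
  proof (cases "z = 0")
    case False
    then have "\<exists>l. vec_nth z l \<noteq> 0" by (auto simp: Finite_Cartesian_Product.vec_eq_iff)
    then have "vec_nth z (SOME l. vec_nth z l \<noteq> 0) \<noteq> 0" by (rule someI_ex)
    then show ?thesis using False by (simp add: \<mu>_def monomial_eval_def)
  qed (simp add: \<mu>_def monomial_eval_def)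
  then have "SS_coeff Z (Some a) \<noteq> 0"
    using SS_coeff_top[OF Z a] by (simp add: a_def)
  then show ?thesis using that[of a] a by (simp add: a_def)
qed

lemma SS_coeff_eq:
  assumes "SS Z = SS Z'" and "c \<in> Cmp"
  shows "SS_coeff Z c = SS_coeff Z' c"
  using assms unfolding SS_def by (metis restrict_apply')

text \<open>A non-zero coefficient of size \<open>m \<times> n\<close> can only come from an array at least that large.\<close>
lemma tight_SS_size_le:
  assumes Z: "tight m n Z" and Z': "tight m' n' Z'" and SS: "SS Z = SS Z'"
  shows "m \<le> m' \<and> n \<le> n'"
proof (cases "m = 0")
  case True
  then have "n = 0" using tightD(3)[OF Z, of 0] by auto
  then show ?thesis using True by simp
next
  case False
  then obtain a where "Some a \<in> Cmp" "dim_row a = m" "dim_col a = n" "SS_coeff Z (Some a) \<noteq> 0"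
    using tight_top_composition[OF Z] by blast
  then show ?thesis using SS_coeff_nonzero_size[OF Z'] SS_coeff_eq[OF SS] by metis
qed

text \<open>
  Once the sizes agree, the entries are quotients of coefficients at full size: enlarging the entry
  \<open>(s, t)\<close> of a composition by one letter multiplies its coefficient by one component of \<open>Z (s, t)\<close>.
\<close>
lemma tight_SS_inject:
  fixes Z Z' :: "nat \<times> nat \<Rightarrow> 'a::idom ^ 'd"
  assumes Z: "tight m n Z" and Z': "tight m' n' Z'" and SS: "SS Z = SS Z'"
  shows "Z = Z'"
proof -
  have mn: "m' = m" "n' = n"
    using tight_SS_size_le[OF Z Z' SS] tight_SS_size_le[OF Z' Z SS[symmetric]] by auto
  note Z' = Z'[unfolded mn]
  have eq: "Z (s, t) = Z' (s, t)" if st: "s < m" "t < n" for s t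
  proof -
    have "0 < m" using st(1) by simp
    then obtain a where a: "Some a \<in> Cmp" and dim: "dim_row a = m" "dim_col a = n"
      and nz: "SS_coeff Z (Some a) \<noteq> 0"
      using tight_top_composition[OF Z] by blast
    have nz': "SS_coeff Z' (Some a) = SS_coeff Z (Some a)" using SS_coeff_eq[OF SS a] by simp
    have "vec_nth (Z (s, t)) l = vec_nth (Z' (s, t)) l" for l
    proof -
      define b where "b = mat m n (\<lambda>p. if p = (s, t) then add_mset l (a $$ p) else a $$ p)"
      have dim_b: "dim_row b = m" "dim_col b = n" by (simp_all add: b_def)
      have "b $$ (i, j) \<noteq> {#}" if "a $$ (i, j) \<noteq> {#}" "i < m" "j < n" for i j
        using that by (simp add: b_def)
      then have b: "Some b \<in> Cmp" using a unfolding Some_in_Cmp_iff dim dim_b by blast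
      have coeff_b: "SS_coeff W (Some b) = vec_nth (W (s, t)) l * SS_coeff W (Some a)"
        if W: "tight m n W" for W :: "nat \<times> nat \<Rightarrow> 'a ^ 'd"
      proof -
        let ?E = "\<lambda>c p. monomial_eval (W p) (c $$ p)"
        let ?P = "{..<m} \<times> {..<n}"
        have top: "SS_coeff W (Some c) = (\<Prod>p\<in>?P. ?E c p)"
          if "Some c \<in> Cmp" "dim_row c = m" "dim_col c = n" for c
          using SS_coeff_top[OF W that] by (simp add: prod.cartesian_product case_prod_unfold)
        have split: "(\<Prod>p\<in>?P. ?E c p) = ?E c (s, t) * (\<Prod>p\<in>?P - {(s, t)}. ?E c p)" for c
          using st by (intro prod.remove) auto
        have "(\<Prod>p\<in>?P - {(s, t)}. ?E b p) = (\<Prod>p\<in>?P - {(s, t)}. ?E a p)"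
        proof (rule prod.cong[OF refl])
          fix p
          assume p: "p \<in> ?P - {(s, t)}"
          then have "b $$ p = a $$ p" by (cases p) (simp add: b_def)
          then show "?E b p = ?E a p" by simp
        qed
        moreover have "?E b (s, t) = vec_nth (W (s, t)) l * ?E a (s, t)"
          using st by (simp add: b_def monomial_eval_def)
        ultimately show ?thesis
          unfolding top[OF b dim_b] top[OF a dim] split by (simp add: mult.assoc)
      qed
      show ?thesis
        using SS_coeff_eq[OF SS b] coeff_b[OF Z] coeff_b[OF Z'] nz nz' by simp
    qed
    then show ?thesis by (simp add: Finite_Cartesian_Product.vec_eq_iff)
  qed
  show ?thesis
  proof (rule ext, clarify)
    fix i j
    show "Z (i, j) = Z' (i, j)" using eq tightD(1)[OF Z] tightD(1)[OF Z'] by metis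
  qed
qed


section \<open>Warping normal forms\<close>

text \<open>
  A zero row of \<open>delta X\<close> says that two consecutive rows of \<open>X\<close> have constant difference, and far
  out to the right this difference is zero.
\<close>
lemma delta_zero_row:
  assumes X: "const_outside n c X" and zero: "\<And>j. delta X (i, j) = 0"
  shows "X (i, j) = X (i + 1, j)"
proof -
  have step: "X (i + 1, j + 1) - X (i, j + 1) = X (i + 1, j) - X (i, j)" for j
    using zero[of j] by (simp add: delta_def algebra_simps)
  have const: "X (i + 1, j) - X (i, j) = X (i + 1, 0) - X (i, 0)" for j
    by (induction j) (use step in auto)
  have "X (i + 1, Suc (snd n)) - X (i, Suc (snd n)) = 0"
    by (simp add: const_outsideD[OF X])
  then show ?thesis using const by (metis eq_iff_diff_eq_0)
qed

text \<open>
  A zero row \<open>i\<close> of \<open>delta X\<close> means that rows \<open>i\<close> and \<open>i + 1\<close> of \<open>X\<close> agree. For \<open>i < ev_rows X\<close> this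
  is a forbidden repetition. For \<open>i = ev_rows X\<close> it makes row \<open>i\<close> constant, so the box could be
  shortened, unless \<open>i = 0\<close>; in that case \<open>X\<close> itself is constant.
\<close>
lemma no_repeats_delta_row_nonzero:
  assumes X: "X \<in> evC" and nr: "no_repeats X" and nonconst: "delta X \<noteq> (\<lambda>_. 0)"
    and i: "i \<le> ev_rows X"
  shows "\<exists>j. delta X (i, j) \<noteq> 0"
proof (rule ccontr)
  assume zero: "\<not> ?thesis"
  obtain c where c: "const_outside (ev_size X) c X"
    and least: "\<And>n c'. const_outside n c' X \<Longrightarrow> ev_size X \<le> n"
    using ev_size_least[OF X] by blast
  have rep: "X (i, j) = X (i + 1, j)" for j
    using delta_zero_row[OF c] zero by blast
  then have "i = ev_rows X" using nr i unfolding no_repeats_def by (metis le_neq_implies_less)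
  then have row: "X (i, j) = c" if "fst (ev_size X) \<le> i" for i j
    using that rep[of j] const_outsideD[OF c] unfolding ev_rows_def
    by (metis le_neq_implies_less less_add_one)
  show False
  proof (cases "ev_rows X")
    case 0
    then have "X (i, j) = c" for i j using row by (simp add: ev_rows_def)
    then show False using nonconst by (auto simp: delta_def fun_eq_iff)
  next
    case (Suc r)
    have "const_outside (r, snd (ev_size X)) c X"
      using Suc row const_outsideD[OF c]
      by (auto simp: const_outside_def less_eq_prod_def ev_rows_def not_le Suc_le_eq)
    then show False using least Suc by (fastforce simp: ev_rows_def less_eq_prod_def)
  qed
qed

text \<open>
  The constant functions are separated because their box still consists of one cell, while the
  rectangle filled by \<open>delta X\<close> is then empty. Otherwise the rectangle has \<open>ev_rows X + 1\<close> rows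
  because indices start at zero; similarly for columns.
\<close>
lemma no_repeats_delta_tight:
  assumes X: "X \<in> evC" and nr: "no_repeats X"
  shows "\<exists>m n. tight m n (delta X)"
proof (cases "delta X = (\<lambda>_. 0)")
  case True
  then have "tight 0 0 (delta X)" by (simp add: tight_def)
  then show ?thesis by blast
next
  case False
  obtain c where c: "const_outside (ev_size X) c X" using ev_size_least[OF X] by blast
  have "delta X (i, j) = 0" if "\<not> (i < Suc (ev_rows X) \<and> j < Suc (ev_cols X))" for i j
    using that const_outsideD[OF c] by (auto simp: delta_def ev_rows_def ev_cols_def)
  moreover have "\<exists>j. delta X (i, j) \<noteq> 0" if "i < Suc (ev_rows X)" for i
    using no_repeats_delta_row_nonzero[OF X nr False] that by simp
  moreover have "\<exists>i. delta X (i, j) \<noteq> 0" if "j < Suc (ev_cols X)" for j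
  proof -
    have "delta (X \<circ> prod.swap) \<noteq> (\<lambda>_. 0)"
      using False unfolding delta_swap by (metis comp_apply swap_swap ext)
    then show ?thesis
      using no_repeats_delta_row_nonzero[of "X \<circ> prod.swap" j] X nr that
      by (auto simp: evC_swap no_repeats_swap ev_rows_def ev_cols_def ev_size_swap delta_swap)
  qed
  ultimately have "tight (Suc (ev_rows X)) (Suc (ev_cols X)) (delta X)"
    unfolding tight_def by metis
  then show ?thesis by blast
qed

lemma no_repeats_SS_inject:
  fixes X Y :: "nat \<times> nat \<Rightarrow> 'a::idom ^ 'd"
  assumes "X \<in> evC" "no_repeats X" "Y \<in> evC" "no_repeats Y" and "SS (delta X) = SS (delta Y)"
  shows "delta X = delta Y"
  using assms no_repeats_delta_tight tight_SS_inject by metis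

text \<open>
  Both normal forms have the signature of \<open>A\<close>, so their differences agree by rigidity, and
  both have the eventual value of \<open>A\<close>; these two data determine a function.
\<close>
lemma warp_normal_form_unique:
  fixes A B B' :: "nat \<times> nat \<Rightarrow> 'a::idom ^ 'd"
  assumes B: "B \<in> evC" "warps_to B A" "no_repeats B"
    and B': "B' \<in> evC" "warps_to B' A" "no_repeats B'"
  shows "B = B'"
proof -
  have delta: "delta B = delta B'"
    using no_repeats_SS_inject B B' SS_delta_warps_to by metis
  obtain n c n' c' where c: "const_outside n c B" and c': "const_outside n' c' B'"
    using B(1) B'(1) by (auto simp: evC_iff_const_outside)
  have "c = c'"
    using const_outside_warps_to[OF B(2) c] const_outside_warps_to[OF B'(2) c']
      const_outside_value_unique by blast
  then have "(\<lambda>i. B i - c) = (\<lambda>i. B' i - c)"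
    using varsigma_delta[OF c] varsigma_delta[OF c'] delta by simp
  then show ?thesis by (auto simp: fun_eq_iff)
qed

lemma NF_warp_props:
  fixes A :: "nat \<times> nat \<Rightarrow> 'a::idom ^ 'd"
  assumes "A \<in> evC"
  shows "NF_warp A \<in> evC" and "warps_to (NF_warp A) A" and "no_repeats (NF_warp A)"
proof -
  have "\<exists>!B. B \<in> evC \<and> warps_to B A \<and> no_repeats B"
    using warp_normal_form_exists[OF assms] warp_normal_form_unique by blast
  from theI'[OF this] show "NF_warp A \<in> evC" "warps_to (NF_warp A) A" "no_repeats (NF_warp A)"
    by (auto simp: NF_warp_def)
qed

lemma NF_warp_idem:
  fixes A :: "nat \<times> nat \<Rightarrow> 'a::idom ^ 'd"
  assumes "A \<in> evC"
  shows "NF_warp (NF_warp A) = NF_warp A"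
  using warp_normal_form_unique NF_warp_props assms warps_to_refl by metis

lemma SS_delta_NF_warp:
  fixes A :: "nat \<times> nat \<Rightarrow> 'a::idom ^ 'd"
  assumes "A \<in> evC"
  shows "SS (delta (NF_warp A)) = SS (delta A)"
  using SS_delta_warps_to[OF NF_warp_props(2)[OF assms]] by simp


section \<open>Equivalence modulo constants or warping\<close>

text \<open>The signature is constant along each generating step of the equivalence.\<close>
lemma sim_imp_SS_eq:
  fixes X Y :: "nat \<times> nat \<Rightarrow> 'a::idom ^ 'd"
  assumes "sim X Y"
  shows "SS (delta X) = SS (delta Y)"
proof -
  have step: "SS (delta U) = SS (delta V)"
    if "U \<in> evC \<and> V \<in> evC \<and> (U - V \<in> ker_delta \<or> NF_warp U = NF_warp V)"
    for U V :: "nat \<times> nat \<Rightarrow> 'a ^ 'd"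
    using that diff_in_ker_delta_iff SS_delta_NF_warp by metis
  show ?thesis
    using assms unfolding sim_def by (induction rule: tranclp_induct) (auto dest!: step)
qed

text \<open>Three steps suffice: \<open>X\<close> to its normal form, a change by a constant, and back to \<open>Y\<close>.\<close>
lemma delta_NF_warp_eq_imp_sim:
  fixes X Y :: "nat \<times> nat \<Rightarrow> 'a::idom ^ 'd"
  assumes X: "X \<in> evC" and Y: "Y \<in> evC" and eq: "delta (NF_warp X) = delta (NF_warp Y)"
  shows "sim X Y"
proof -
  define R where "R = (\<lambda>X Y :: nat \<times> nat \<Rightarrow> 'a ^ 'd.
    X \<in> evC \<and> Y \<in> evC \<and> (X - Y \<in> ker_delta \<or> NF_warp X = NF_warp Y))"
  have "R X (NF_warp X)" and "R (NF_warp Y) Y"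
    using X Y by (simp_all add: R_def NF_warp_props NF_warp_idem)
  moreover have "R (NF_warp X) (NF_warp Y)"
    using X Y eq by (simp add: R_def NF_warp_props diff_in_ker_delta_iff)
  ultimately have "R\<^sup>+\<^sup>+ X Y"
    by (meson tranclp.r_into_trancl tranclp.trancl_into_trancl)
  then show ?thesis by (simp add: sim_def R_def)
qed

theorem theorem2p31:
  fixes X Y :: "nat \<times> nat \<Rightarrow> 'a::idom ^ 'd::finite"
  assumes "X \<in> evC" and "Y \<in> evC"
  shows "(sim X Y \<longleftrightarrow> NF_sim X = NF_sim Y) \<and>
         (NF_sim X = NF_sim Y \<longleftrightarrow> SS (delta X) = SS (delta Y))"
proof -
  have NF: "NF_sim X = NF_sim Y \<longleftrightarrow> delta (NF_warp X) = delta (NF_warp Y)"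
    unfolding NF_sim_def comp_apply
    by (rule NF_ker_delta_eq_iff) (simp_all add: NF_warp_props assms)
  have "delta (NF_warp X) = delta (NF_warp Y) \<longleftrightarrow> SS (delta X) = SS (delta Y)"
    using no_repeats_SS_inject NF_warp_props SS_delta_NF_warp assms by metis
  then show ?thesis
    using NF sim_imp_SS_eq delta_NF_warp_eq_imp_sim[OF assms] by blast
qed

end
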